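(* Let $W\in\mathbb{R}^{n\times n}$ be the weight matrix of an undirected weighted graph on $n$ vertices, let $L(W)=\mathrm{diag}(W\mathbf{1})-W$ be its graph Laplacian, with eigenvalues $\lambda_1\le\lambda_2\le\dots\le\lambda_n$ (counted with multiplicity), and let $1\le k\le n-1$. Then the $k$th spectral gap, divided by $\sqrt2$, is characterized as $$ \frac{\lambda_{k+1}-\lambda_k}{\sqrt2}=\min\left\{\,\|L(W)-\widehat L\|_F \;:\; \widehat L\in\mathrm{Sym}(n),\ \lambda_k(\widehat L)=\lambda_{k+1}(\widehat L)\right\}, $$ where $\mathrm{Sym}(n)$ denotes the set of all symmetric real $n\times n$ matrices.
   Context: The graph has vertex set $\{1,\dots,n\}$ and a symmetric edge set $\mathcal{E}\subset\{1,\dots,n\}^2$; its weight matrix $W=(w_{ij})$ satisfies $w_{ij}=w_{ji}\ge 0$, and $w_{ij}=0$ for $(i,j)\notin\mathcal{E}$. Here $\mathbf{1}=(1,\dots,1)^T\in\mathbb{R}^n$, and $\mathrm{diag}(v)$ is the diagonal matrix with diagonal $v$. For a symmetric matrix $A$, $\lambda_i(A)$ denotes its $i$th smallest eigenvalue, counted with multiplicity. $\|A\|_F=\sqrt{\sum_{i,j}a_{ij}^2}$ is the Frobenius norm. *)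

theory Defs
  imports Complex_Main "Jordan_Normal_Form.Char_Poly"
begin

text \<open>Vertices and matrix indices are numbered 0, ..., n - 1, as usual for matrices here,
  whereas eigenvalues are numbered from 1.\<close>

definition weighted_graph :: "nat \<Rightarrow> (nat \<times> nat) set \<Rightarrow> real mat \<Rightarrow> bool" where
  "weighted_graph n E W \<longleftrightarrow>
     E \<subseteq> {..<n} \<times> {..<n} \<and> sym E \<and> W \<in> carrier_mat n n \<and>
     (\<forall>i<n. \<forall>j<n. W $$ (i,j) = W $$ (j,i) \<and> 0 \<le> W $$ (i,j)) \<and>
     (\<forall>i<n. \<forall>j<n. (i,j) \<notin> E \<longrightarrow> W $$ (i,j) = 0)"

definition ones_vec :: "nat \<Rightarrow> real vec" where
  "ones_vec n = vec n (\<lambda>_. 1)"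

definition diag_of_vec :: "real vec \<Rightarrow> real mat" where
  "diag_of_vec v = mat_diag (dim_vec v) (\<lambda>i. v $ i)"

definition laplacian :: "real mat \<Rightarrow> real mat" where
  "laplacian W = diag_of_vec (W *\<^sub>v ones_vec (dim_col W)) - W"

definition Sym :: "nat \<Rightarrow> real mat set" where
  "Sym n = {A \<in> carrier_mat n n. A\<^sup>T = A}"

text \<open>The i-th smallest eigenvalue, for i from 1 to n, of a symmetric matrix of size n. The
  characteristic polynomial of such a matrix splits over the reals, so the list of its real roots
  with multiplicity has length n; nothing is intended for other matrices or indices.\<close>

definition eigval :: "nat \<Rightarrow> real mat \<Rightarrow> real" where
  "eigval i A = sorted_list_of_multiset (proots (char_poly A)) ! (i - 1)"

definition frobenius_norm :: "real mat \<Rightarrow> real" where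
  "frobenius_norm A = sqrt (\<Sum>i<dim_row A. \<Sum>j<dim_col A. (A $$ (i,j))\<^sup>2)"

text \<open>The operator \<^const>\<open>Min\<close> is meaningful only on finite sets, hence the following; it
  includes that the minimum is attained.\<close>

definition is_minimum :: "real \<Rightarrow> real set \<Rightarrow> bool" where
  "is_minimum m S \<longleftrightarrow> m \<in> S \<and> (\<forall>x\<in>S. m \<le> x)"

end

theory Submission
  imports Defs "Jordan_Normal_Form.Schur_Decomposition"
begin

text \<open>Let \<open>L\<close> be symmetric with orthonormal eigenvectors \<open>u\<^sub>1, \<dots>, u\<^sub>n\<close>, and let \<open>M\<close> be symmetric with
  \<open>\<lambda>\<^sub>k(M) = \<lambda>\<^sub>k\<^sub>+\<^sub>1(M) = \<mu>\<close> and orthonormal eigenvectors \<open>v\<^sub>1, \<dots>, v\<^sub>n\<close>. By counting dimensions there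
  are unit vectors \<open>x\<close> in \<open>span {u\<^sub>1, \<dots>, u\<^sub>k} \<inter> span {v\<^sub>k, \<dots>, v\<^sub>n}\<close> and \<open>y\<close> in
  \<open>span {u\<^sub>k\<^sub>+\<^sub>1, \<dots>, u\<^sub>n} \<inter> span {v\<^sub>1, \<dots>, v\<^sub>k\<^sub>+\<^sub>1}\<close>. They are orthogonal, and the quadratic form of
  \<open>L - M\<close> is at most \<open>\<lambda>\<^sub>k - \<mu>\<close> at \<open>x\<close> and at least \<open>\<lambda>\<^sub>k\<^sub>+\<^sub>1 - \<mu>\<close> at \<open>y\<close>. So the Frobenius inner
  product of \<open>L - M\<close> with \<open>y y\<^sup>T - x x\<^sup>T\<close>, a matrix of Frobenius norm \<open>\<surd>2\<close>, is at least
  \<open>\<lambda>\<^sub>k\<^sub>+\<^sub>1 - \<lambda>\<^sub>k\<close>, and Cauchy-Schwarz gives the lower bound. It is attained by replacing both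
  \<open>\<lambda>\<^sub>k\<close> and \<open>\<lambda>\<^sub>k\<^sub>+\<^sub>1\<close> by their mean in the spectral decomposition of \<open>L\<close>.\<close>

section \<open>Orthogonal diagonalization of real symmetric matrices\<close>

text \<open>Complete \<open>v\<close> to a basis, orthogonalize, then normalize. Gram-Schmidt leaves
  the head of the list unchanged, so the first column stays a multiple of \<open>v\<close>.\<close>

lemma orthogonal_mat_extending_vec:
  fixes v :: "real vec"
  assumes v: "v \<in> carrier_vec n" and v0: "v \<noteq> 0\<^sub>v n"
  obtains W c where "W \<in> carrier_mat n n" "W\<^sup>T * W = 1\<^sub>m n" "W * W\<^sup>T = 1\<^sub>m n" "col W 0 = c \<cdot>\<^sub>v v"
proof -
  interpret cof_vec_space n "TYPE(real)" .
  define b where "b = basis_completion v"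
  define ws where "ws = gram_schmidt n b"
  define us where "us = map (\<lambda>w. (1 / sqrt (w \<bullet> w)) \<cdot>\<^sub>v w) ws"
  define W where "W = mat_of_cols n us"
  from basis_completion[OF v v0, folded b_def]
  have dist_b: "distinct b" and indep: "\<not> lin_dep (set b)" and b: "set b \<subseteq> carrier_vec n"
    and hdb: "hd b = v" and len_b: "length b = n" by auto
  from gram_schmidt_result[OF b dist_b indep refl, folded ws_def]
  have ws: "set ws \<subseteq> carrier_vec n" "corthogonal ws" and len: "length ws = n"
    by (auto simp: len_b)
  have n: "n \<noteq> 0" using v v0 by (intro notI) auto
  with hdb len_b obtain vs where "b = v # vs" by (cases b, auto)
  with gram_schmidt_hd[OF v, of vs] have "hd ws = v" unfolding ws_def by simp
  with len n have ws0: "ws ! 0 = v" by (metis hd_conv_nth length_0_conv)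
  have car: "ws ! i \<in> carrier_vec n" if "i < n" for i using ws len that by auto
  have W: "W \<in> carrier_mat n n" unfolding W_def us_def using len by auto
  have colW: "col W i = (1 / sqrt (ws ! i \<bullet> ws ! i)) \<cdot>\<^sub>v ws ! i" if "i < n" for i
    unfolding W_def using that car[OF that] len by (subst col_mat_of_cols) (auto simp: us_def)
  have orth: "ws ! i \<bullet> ws ! j = 0 \<longleftrightarrow> i \<noteq> j" if "i < n" "j < n" for i j
    using corthogonalD[OF ws(2)] that len by simp
  have WW: "W\<^sup>T * W = 1\<^sub>m n"
  proof (rule eq_matI)
    fix i j assume ij: "i < dim_row (1\<^sub>m n :: real mat)" "j < dim_col (1\<^sub>m n :: real mat)"
    have pos: "0 \<le> ws ! i \<bullet> ws ! i" by (simp add: scalar_prod_def sum_nonneg)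
    have "(W\<^sup>T * W) $$ (i, j) = col W i \<bullet> col W j" using W ij by auto
    also have "\<dots> = (1\<^sub>m n) $$ (i, j)"
      using ij car[of i] car[of j] orth[of i j] pos by (cases "i = j") (auto simp: colW)
    finally show "(W\<^sup>T * W) $$ (i, j) = 1\<^sub>m n $$ (i, j)" .
  qed (use W in auto)
  moreover have "W * W\<^sup>T = 1\<^sub>m n"
    using mat_mult_left_right_inverse[OF _ W WW] W by auto
  ultimately show thesis using that[OF W] colW[of 0] n ws0 by auto
qed

text \<open>Deflation: conjugating by an orthogonal matrix whose first column is an eigenvector for
  the first root splits off a 1 by 1 block, and the rest is again symmetric, with the remaining
  roots. The inverse witness being \<open>P\<^sup>T\<close> makes \<open>P\<close> orthogonal. The
  diagonal keeps the order of \<open>es\<close>, so a sorted list gives sorted eigenvalues.\<close>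

lemma real_symmetric_diagonalization:
  fixes A :: "real mat"
  assumes "A \<in> carrier_mat n n" "A\<^sup>T = A" "char_poly A = (\<Prod>e\<leftarrow>es. [:- e, 1:])"
  shows "\<exists>P. similar_mat_wit A (mat_diag n ((!) es)) P P\<^sup>T"
  using assms
proof (induct es arbitrary: n A)
  case Nil
  with degree_monic_char_poly[of A n] have "n = 0" by auto
  with Nil(1) show ?case
    by (intro exI[of _ "1\<^sub>m 0"] similar_mat_witI[of _ _ 0]) auto
next
  case (Cons e es n A)
  note A = Cons(2)
  define m where "m = n - 1"
  have mon: "monic (\<Prod>e\<leftarrow>es. [:- e, 1:])" by (rule monic_prod_list, auto)
  have "degree (char_poly A) = Suc (degree (\<Prod>e\<leftarrow>es. [:- e, 1:]))"
    unfolding Cons(4) list.map prod_list.Cons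
    by (subst degree_mult_eq, insert mon, auto)
  with degree_monic_char_poly[OF A] have n: "n = Suc m" unfolding m_def by auto
  have "eigenvalue A e"
    unfolding eigenvalue_root_char_poly[OF A] Cons(4) by simp
  then obtain v where v: "v \<in> carrier_vec n" "v \<noteq> 0\<^sub>v n" "A *\<^sub>v v = e \<cdot>\<^sub>v v"
    unfolding eigenvalue_def eigenvector_def using A by auto
  from orthogonal_mat_extending_vec[OF v(1,2)] obtain W c where W: "W \<in> carrier_mat n n"
    "W\<^sup>T * W = 1\<^sub>m n" "W * W\<^sup>T = 1\<^sub>m n" and Wc: "col W 0 = c \<cdot>\<^sub>v v" by metis
  define B where "B = W\<^sup>T * A * W"
  have B: "B \<in> carrier_mat n n" using A W(1) by (auto simp: B_def)
  note [simp] = assoc_mult_mat[of _ n n _ n _ n]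
  have Bsym: "B\<^sup>T = B"
    unfolding B_def using A W(1) Cons(3) by (simp add: transpose_mult[of _ n n _ n])
  have "A = (W * W\<^sup>T) * A * (W * W\<^sup>T)" using A W(3) by simp
  also have "\<dots> = W * B * W\<^sup>T" unfolding B_def using A W(1) by simp
  finally have AB: "similar_mat_wit A B W W\<^sup>T"
    using W A B by (intro similar_mat_witI[of _ _ n]) auto
  have B0: "B $$ (i, 0) = (if i = 0 then e else 0)" if "i < n" for i
  proof -
    have "A *\<^sub>v col W 0 = e \<cdot>\<^sub>v col W 0"
      using v A by (simp add: Wc mult_mat_vec[OF A v(1)] smult_smult_assoc mult.commute)
    then have ev: "col W i \<bullet> (A *\<^sub>v col W 0) = e * (col W i \<bullet> col W 0)"
      using W(1) by simp
    have "B $$ (i, 0) = (W\<^sup>T * (A * W)) $$ (i, 0)" unfolding B_def using A W(1) by simp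
    also have "\<dots> = col W i \<bullet> (A *\<^sub>v col W 0)"
      using A W(1) that by (auto simp: n mult_mat_vec_def)
    also have "\<dots> = e * (W\<^sup>T * W) $$ (i, 0)" unfolding ev using that n W(1) by auto
    finally have "B $$ (i, 0) = e * (W\<^sup>T * W) $$ (i, 0)" .
    then show ?thesis unfolding W(2) using that n by auto
  qed
  \<comment> \<open>Symmetry makes the first row vanish off the diagonal too, so \<open>B\<close> is
    block diagonal rather than merely block triangular.\<close>
  have B0': "B $$ (0, i) = (if i = 0 then e else 0)" if "i < n" for i
    using B0[OF that] arg_cong[OF Bsym, of "\<lambda>M. M $$ (0, i)"] B that n by simp
  define C where "C = mat m m (\<lambda>(i, j). B $$ (Suc i, Suc j))"
  have C: "C \<in> carrier_mat m m" by (simp add: C_def)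
  have Bblock: "B = four_block_mat (mat 1 1 (\<lambda>_. e)) (0\<^sub>m 1 m) (0\<^sub>m m 1) C"
    using B B0 B0' by (intro eq_matI) (auto simp: n C_def)
  have Csym: "C\<^sup>T = C"
  proof (rule eq_matI)
    fix i j assume "i < dim_row C" "j < dim_col C"
    then show "C\<^sup>T $$ (i, j) = C $$ (i, j)"
      using arg_cong[OF Bsym, of "\<lambda>M. M $$ (Suc i, Suc j)"] B by (simp add: C_def n)
  qed (simp_all add: C_def)
  have "char_poly (mat 1 1 (\<lambda>_. e)) = [:- e, 1:]"
    by (subst char_poly_upper_triangular[of _ 1]) (auto simp: upper_triangular_def diag_mat_def)
  then have "char_poly B = [:- e, 1:] * char_poly C"
    unfolding Bblock using C by (subst char_poly_four_block_zeros_col) auto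
  moreover have "char_poly B = char_poly A"
    using AB char_poly_similar[of A B] unfolding similar_mat_def by metis
  ultimately have "[:- e, 1:] * char_poly C = [:- e, 1:] * (\<Prod>e\<leftarrow>es. [:- e, 1:])"
    using Cons(4) by simp
  then have "char_poly C = (\<Prod>e\<leftarrow>es. [:- e, 1:])"
    by (subst (asm) mult_left_cancel) simp_all
  from Cons(1)[OF C Csym this] obtain P where
    P: "similar_mat_wit C (mat_diag m ((!) es)) P P\<^sup>T" by blast
  let ?P = "four_block_mat (1\<^sub>m 1) (0\<^sub>m 1 m) (0\<^sub>m m 1) P"
  from similar_mat_witD2[OF C P] have Pc: "P \<in> carrier_mat m m" by auto
  have "similar_mat_wit B (four_block_mat (mat 1 1 (\<lambda>_. e)) (0\<^sub>m 1 m) (0\<^sub>m m 1) (mat_diag m ((!) es)))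
    ?P (four_block_mat (1\<^sub>m 1) (0\<^sub>m 1 m) (0\<^sub>m m 1) P\<^sup>T)"
    unfolding Bblock
    by (rule similar_mat_wit_four_block[OF similar_mat_wit_refl P]) (use C Pc in auto)
  moreover have "four_block_mat (mat 1 1 (\<lambda>_. e)) (0\<^sub>m 1 m) (0\<^sub>m m 1) (mat_diag m ((!) es))
     = mat_diag n ((!) (e # es))"
    by (rule eq_matI) (auto simp: n mat_diag_def)
  moreover have "four_block_mat (1\<^sub>m 1) (0\<^sub>m 1 m) (0\<^sub>m m 1) P\<^sup>T = ?P\<^sup>T"
    using Pc by (subst transpose_four_block_mat) auto
  ultimately have "similar_mat_wit B (mat_diag n ((!) (e # es))) ?P ?P\<^sup>T" by simp
  from similar_mat_wit_trans[OF AB this]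
  have "similar_mat_wit A (mat_diag n ((!) (e # es))) (W * ?P) (?P\<^sup>T * W\<^sup>T)" .
  moreover have "?P\<^sup>T * W\<^sup>T = (W * ?P)\<^sup>T"
    using W(1) Pc n by (intro transpose_mult[symmetric, of _ n n]) auto
  ultimately show ?case by auto
qed

text \<open>Moving the real symmetric matrix across the Hermitian product of an eigenvector with
  itself turns the factor \<open>a\<close> into \<open>cnj a\<close>.\<close>

lemma symmetric_eigenvalue_real:
  assumes A: "A \<in> carrier_mat n n" and sym: "A\<^sup>T = (A :: real mat)"
    and a: "eigenvalue (map_mat complex_of_real A) a"
  shows "a \<in> \<real>"
proof -
  let ?A = "map_mat complex_of_real A"
  have A': "?A \<in> carrier_mat n n" using A by simp
  from a obtain v where v: "v \<in> carrier_vec n" "v \<noteq> 0\<^sub>v n" "?A *\<^sub>v v = a \<cdot>\<^sub>v v"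
    unfolding eigenvalue_def eigenvector_def using A by auto
  have cv: "conjugate v \<in> carrier_vec n" using v by simp
  have conj: "conjugate (?A *\<^sub>v v) = ?A *\<^sub>v conjugate v"
    using A v(1) by (intro eq_vecI) (auto simp: scalar_prod_def)
  have "?A\<^sup>T = ?A" using sym by (metis map_mat_transpose)
  have "a * (v \<bullet>c v) = (?A\<^sup>T *\<^sub>v v) \<bullet>c v"
    using v(1) cv unfolding \<open>?A\<^sup>T = ?A\<close> v(3) by simp
  also have "\<dots> = v \<bullet> (?A *\<^sub>v conjugate v)"
    by (rule transpose_vec_mult_scalar[OF A' cv v(1)])
  also have "\<dots> = cnj a * (v \<bullet>c v)"
    unfolding conj[symmetric] v(3) using v by (simp add: conjugate_smult_vec)
  finally have "a = cnj a" using v by simp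
  then show ?thesis by (simp add: Reals_cnj_iff)
qed

text \<open>Factor over the complex numbers, where all roots turn out to be real, and descend by
  injectivity of the embedding of polynomials.\<close>

lemma char_poly_symmetric_splits:
  fixes A :: "real mat"
  assumes A: "A \<in> carrier_mat n n" and sym: "A\<^sup>T = A"
  shows "\<exists>es. char_poly A = (\<Prod>e\<leftarrow>es. [:- e, 1:])"
proof -
  interpret poly_hom: map_poly_inj_idom_hom complex_of_real ..
  let ?A = "map_mat complex_of_real A"
  have A': "?A \<in> carrier_mat n n" using A by simp
  from char_poly_factorized[OF A'] obtain as where
    as: "char_poly ?A = (\<Prod>a\<leftarrow>as. [:- a, 1:])" by auto
  have "a \<in> \<real>" if "a \<in> set as" for a
  proof -
    have "eigenvalue ?A a" unfolding eigenvalue_root_char_poly[OF A'] as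
      using that by (auto simp: poly_prod_list prod_list_zero_iff)
    then show ?thesis by (rule symmetric_eigenvalue_real[OF A sym])
  qed
  then have "map of_real (map Re as) = as" by (induct as) auto
  moreover have "map_poly complex_of_real (\<Prod>e\<leftarrow>bs. [:- e, 1:])
      = (\<Prod>a\<leftarrow>map of_real bs. [:- a, 1:])" for bs
    by (induct bs) (simp_all add: poly_hom.hom_mult del: mult_pCons_left)
  ultimately have "char_poly ?A = map_poly of_real (\<Prod>e\<leftarrow>map Re as. [:- e, 1:])"
    using as by metis
  moreover have "char_poly ?A = map_poly of_real (char_poly A)"
    by (rule of_real_hom.char_poly_hom[OF A])
  ultimately show ?thesis using poly_hom.injectivity by metis
qed

section \<open>Ordered eigenvalues\<close>

lemma eigval_eq_nth:
  assumes "char_poly A = (\<Prod>e\<leftarrow>es. [:- e, 1:])" "sorted es"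
  shows "eigval i A = es ! (i - 1)"
proof -
  have "proots (\<Prod>e\<leftarrow>es. [:- e, 1:]) = mset es"
  proof (induct es)
    case (Cons a es)
    moreover have "(\<Prod>e\<leftarrow>es. [:- e, 1:]) \<noteq> 0" by (auto simp: prod_list_zero_iff)
    ultimately show ?case by (subst list.map, subst prod_list.Cons, subst proots_mult) auto
  qed simp
  with assms show ?thesis
    by (simp add: eigval_def sorted_list_of_multiset_mset sorted_sort_id)
qed

text \<open>Serves to read off the spectrum of a matrix built from a prescribed increasing diagonal,
  as the minimizer will be.\<close>

lemma eigval_of_diagonalization:
  assumes "similar_mat_wit A (mat_diag n d) P Q"
    and "\<And>i j. i \<le> j \<Longrightarrow> j < n \<Longrightarrow> d i \<le> d j" and "1 \<le> i" "i \<le> n"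
  shows "eigval i A = d (i - 1)"
proof -
  have "char_poly A = char_poly (mat_diag n d)"
    using assms(1) char_poly_similar unfolding similar_mat_def by blast
  also have "\<dots> = (\<Prod>e\<leftarrow>map d [0..<n]. [:- e, 1:])"
    by (subst char_poly_upper_triangular[of _ n])
       (auto simp: upper_triangular_def mat_diag_def diag_mat_def intro!: arg_cong[of _ _ prod_list])
  finally have "eigval i A = map d [0..<n] ! (i - 1)"
    by (rule eigval_eq_nth) (use assms(2) in \<open>auto simp: sorted_iff_nth_mono\<close>)
  with assms show ?thesis by simp
qed

lemma spectral_theorem:
  assumes "A \<in> Sym n"
  obtains P where "similar_mat_wit A (mat_diag n (\<lambda>i. eigval (Suc i) A)) P P\<^sup>T"
    and "\<And>i j. i \<le> j \<Longrightarrow> j < n \<Longrightarrow> eigval (Suc i) A \<le> eigval (Suc j) A"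
proof -
  from assms have A: "A \<in> carrier_mat n n" "A\<^sup>T = A" by (auto simp: Sym_def)
  from char_poly_symmetric_splits[OF this] obtain fs where
    "char_poly A = (\<Prod>e\<leftarrow>fs. [:- e, 1:])" by blast
  also have "\<dots> = (\<Prod>e\<leftarrow>sort fs. [:- e, 1:])"
    by (simp flip: prod_mset_prod_list)
  finally have cp: "char_poly A = (\<Prod>e\<leftarrow>sort fs. [:- e, 1:])" .
  have len: "length fs = n"
    using degree_monic_char_poly[OF A(1)] degree_linear_factors[of uminus "sort fs"] by (simp add: cp)
  have ev: "eigval (Suc i) A = sort fs ! i" for i
    using eigval_eq_nth[OF cp, of "Suc i"] by simp
  from real_symmetric_diagonalization[OF A cp] obtain P
    where P: "similar_mat_wit A (mat_diag n ((!) (sort fs))) P P\<^sup>T" by blast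
  show thesis
    by (rule that[of P]) (simp_all add: ev P len sorted_nth_mono)
qed

section \<open>Dimension count and Frobenius estimate\<close>

text \<open>Fewer than \<open>n\<close> homogeneous linear conditions have a nonzero common
  solution: padded with zero rows, they form a singular square matrix.\<close>

lemma unit_vec_orthogonal_to_few:
  fixes rs :: "real vec list"
  assumes rs: "set rs \<subseteq> carrier_vec n" and len: "length rs < n"
  obtains x where "x \<in> carrier_vec n" "x \<bullet> x = 1" "\<And>r. r \<in> set rs \<Longrightarrow> r \<bullet> x = 0"
proof -
  define M where "M = mat_of_rows n (rs @ replicate (n - length rs) (0\<^sub>v n))"
  have M: "M \<in> carrier_mat n n" unfolding M_def using len by auto
  have row: "row M i = rs ! i" if "i < length rs" for i
    unfolding M_def using that rs len by (subst mat_of_rows_row) (auto simp: nth_append)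
  let ?u = "unit_vec n (n - 1) :: real vec"
  \<comment> \<open>The last row of \<open>M\<close> is a padding row, since
    \<open>length rs < n\<close>.\<close>
  have "M\<^sup>T *\<^sub>v ?u = 0\<^sub>v n"
  proof (rule eq_vecI)
    fix i assume i: "i < dim_vec (0\<^sub>v n :: real vec)"
    have "(M\<^sup>T *\<^sub>v ?u) $ i = M $$ (n - 1, i)" using M i by simp
    also have "\<dots> = 0" unfolding M_def using i len by (simp add: mat_of_rows_def nth_append)
    finally show "(M\<^sup>T *\<^sub>v ?u) $ i = 0\<^sub>v n $ i" using i by simp
  qed (use M in auto)
  moreover have "?u $ (n - 1) \<noteq> 0\<^sub>v n $ (n - 1)" using len by simp
  then have "?u \<noteq> 0\<^sub>v n" by auto
  ultimately have "det M\<^sup>T = 0"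
    using det_0_iff_vec_prod_zero[of "M\<^sup>T" n] M by (metis transpose_carrier_mat unit_vec_carrier)
  then have "det M = 0" using det_transpose[OF M] by simp
  then obtain v where v: "v \<in> carrier_vec n" "v \<noteq> 0\<^sub>v n" "M *\<^sub>v v = 0\<^sub>v n"
    using det_0_iff_vec_prod_zero[OF M] by auto
  have "conjugate v = v" by (intro eq_vecI) auto
  then have pos: "v \<bullet> v > 0" using conjugate_square_greater_0_vec[OF v(1)] v(2) by simp
  define x where "x = (1 / sqrt (v \<bullet> v)) \<cdot>\<^sub>v v"
  show thesis
  proof
    show "x \<in> carrier_vec n" unfolding x_def using v by simp
    show "x \<bullet> x = 1" unfolding x_def using v pos by simp
    fix r assume r: "r \<in> set rs"
    then obtain i where i: "i < length rs" "r = rs ! i" by (auto simp: in_set_conv_nth)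
    have "r \<bullet> v = (M *\<^sub>v v) $ i" using i len M row by simp
    then have "r \<bullet> v = 0" using v(3) i len by simp
    moreover have "r \<in> carrier_vec n" using r rs by auto
    ultimately show "r \<bullet> x = 0" unfolding x_def using v by simp
  qed
qed

text \<open>Each term of the expanded square separates into a factor in \<open>i\<close> and one in
  \<open>j\<close>, so the double sum reduces to products of scalar products.\<close>

lemma orthonormal_outer_prod_diff:
  fixes x y :: "real vec"
  assumes x: "x \<in> carrier_vec n" "x \<bullet> x = 1" and y: "y \<in> carrier_vec n" "y \<bullet> y = 1"
    and xy: "x \<bullet> y = 0"
  shows "(\<Sum>i<n. \<Sum>j<n. (y $ i * y $ j - x $ i * x $ j)\<^sup>2) = 2"
proof -
  have "(\<Sum>i<n. \<Sum>j<n. (y $ i * y $ j - x $ i * x $ j)\<^sup>2) =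
      (\<Sum>i<n. \<Sum>j<n. (y $ i * y $ i) * (y $ j * y $ j) + (x $ i * x $ i) * (x $ j * x $ j)
        - 2 * ((x $ i * y $ i) * (x $ j * y $ j)))"
    by (intro sum.cong refl) (simp add: power2_eq_square algebra_simps)
  also have "\<dots> = (y \<bullet> y) * (y \<bullet> y) + (x \<bullet> x) * (x \<bullet> x) - 2 * ((x \<bullet> y) * (x \<bullet> y))"
    using x(1) y(1)
    by (simp add: sum.distrib sum_subtractf scalar_prod_def atLeast0LessThan sum_product
        flip: sum_distrib_left)
  finally show ?thesis using assms by simp
qed

text \<open>The numerator is the Frobenius inner product of \<open>D\<close> with the difference of
  the outer products of \<open>y\<close> and \<open>x\<close>, whose norm was just computed.\<close>

lemma quadratic_form_diff_le_frobenius: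
  fixes D :: "real mat" and x y :: "real vec"
  assumes D: "D \<in> carrier_mat n n"
    and x: "x \<in> carrier_vec n" "x \<bullet> x = 1" and y: "y \<in> carrier_vec n" "y \<bullet> y = 1"
    and xy: "x \<bullet> y = 0"
  shows "(y \<bullet> (D *\<^sub>v y) - x \<bullet> (D *\<^sub>v x)) / sqrt 2 \<le> frobenius_norm D"
proof -
  define s where "s = y \<bullet> (D *\<^sub>v y) - x \<bullet> (D *\<^sub>v x)"
  define T where "T i j = y $ i * y $ j - x $ i * x $ j" for i j
  define N where "N = (\<Sum>i<n. \<Sum>j<n. (D $$ (i, j))\<^sup>2)"
  have s: "s = (\<Sum>i<n. \<Sum>j<n. D $$ (i, j) * T i j)"
    unfolding s_def T_def using D x(1) y(1)
    by (simp add: scalar_prod_def atLeast0LessThan sum_distrib_left sum_subtractf algebra_simps)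
  have T: "(\<Sum>i<n. \<Sum>j<n. (T i j)\<^sup>2) = 2"
    unfolding T_def by (rule orthonormal_outer_prod_diff[OF x y xy])
  \<comment> \<open>Cauchy-Schwarz: \<open>s / 2\<close> is the coefficient of the projection of \<open>D\<close> onto \<open>T\<close>.\<close>
  have "0 \<le> (\<Sum>i<n. \<Sum>j<n. (D $$ (i, j) - s / 2 * T i j)\<^sup>2)"
    by (intro sum_nonneg) simp
  also have "\<dots> = (\<Sum>i<n. \<Sum>j<n. (D $$ (i, j))\<^sup>2 - s * (D $$ (i, j) * T i j) + s\<^sup>2 / 4 * (T i j)\<^sup>2)"
    by (intro sum.cong refl) (simp add: power2_eq_square field_simps)
  also have "\<dots> = N - s * s + s\<^sup>2 / 4 * 2"
    unfolding T[symmetric] by (subst (2) s)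
      (simp only: N_def sum.distrib sum_subtractf sum_distrib_left)
  finally have "s\<^sup>2 / 2 \<le> N" by (simp add: power2_eq_square)
  then have "(s / sqrt 2)\<^sup>2 \<le> N" by (simp add: power_divide)
  then have "s / sqrt 2 \<le> sqrt N" by (rule real_le_rsqrt)
  then show ?thesis using D by (simp add: s_def N_def frobenius_norm_def)
qed

section \<open>Quadratic forms in eigenvector coordinates\<close>

context
  fixes A P :: "real mat" and d :: "nat \<Rightarrow> real" and n :: nat
  assumes A: "A \<in> carrier_mat n n" and diag: "similar_mat_wit A (mat_diag n d) P P\<^sup>T"
begin

lemma diagonalizing_mat: "P \<in> carrier_mat n n" "P * P\<^sup>T = 1\<^sub>m n" "P\<^sup>T * P = 1\<^sub>m n"
    "A = P * mat_diag n d * P\<^sup>T"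
  by (fact similar_mat_witD2[OF A diag])+

text \<open>Parseval's identity for the orthonormal columns of \<open>P\<close>.\<close>

lemma scalar_prod_eq_sum_coords:
  assumes x: "x \<in> carrier_vec n" and y: "y \<in> carrier_vec n"
  shows "x \<bullet> y = (\<Sum>i<n. (col P i \<bullet> x) * (col P i \<bullet> y))"
proof -
  note P = diagonalizing_mat(1)
  have "x \<bullet> y = x \<bullet> (P *\<^sub>v (P\<^sup>T *\<^sub>v y))"
    using P y by (simp add: assoc_mult_mat_vec[of P n n "P\<^sup>T" n y, symmetric] diagonalizing_mat(2))
  also have "\<dots> = (P\<^sup>T *\<^sub>v x) \<bullet> (P\<^sup>T *\<^sub>v y)"
    using P x y by (intro transpose_vec_mult_scalar[symmetric]) auto
  finally show ?thesis using P by (simp add: scalar_prod_def[of "P\<^sup>T *\<^sub>v x"] atLeast0LessThan)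
qed

lemma quadratic_form_eq_sum_coords:
  assumes x: "x \<in> carrier_vec n"
  shows "x \<bullet> (A *\<^sub>v x) = (\<Sum>i<n. d i * (col P i \<bullet> x)\<^sup>2)"
proof -
  note P = diagonalizing_mat(1)
  have D: "mat_diag n d *\<^sub>v z = vec n (\<lambda>i. d i * z $ i)" if z: "z \<in> carrier_vec n" for z
  proof (rule eq_vecI)
    fix i assume "i < dim_vec (vec n (\<lambda>i. d i * z $ i))"
    then show "(mat_diag n d *\<^sub>v z) $ i = vec n (\<lambda>i. d i * z $ i) $ i"
      using z by (simp add: mat_diag_def scalar_prod_def if_distrib[of "\<lambda>t. t * _"] cong: if_cong)
  qed (simp add: mat_diag_def)
  have "x \<bullet> (A *\<^sub>v x) = x \<bullet> (P *\<^sub>v (mat_diag n d *\<^sub>v (P\<^sup>T *\<^sub>v x)))"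
    unfolding diagonalizing_mat(4) using P x
    by (simp add: assoc_mult_mat_vec[of _ n n _ n] mult_carrier_mat[of _ n n _ n])
  also have "\<dots> = (P\<^sup>T *\<^sub>v x) \<bullet> (mat_diag n d *\<^sub>v (P\<^sup>T *\<^sub>v x))"
    using P x by (intro transpose_vec_mult_scalar[symmetric]) (auto simp: D)
  also have "\<dots> = (\<Sum>i<n. d i * (col P i \<bullet> x)\<^sup>2)"
    using P x by (subst D) (auto simp: scalar_prod_def[of "P\<^sup>T *\<^sub>v x"] atLeast0LessThan
        power2_eq_square intro!: sum.cong)
  finally show ?thesis .
qed

text \<open>The form is an average of the \<open>d i\<close> with weights
  \<open>(col P i \<bullet> x)\<^sup>2\<close>, which sum to 1; indices of weight zero put no
  constraint on \<open>d i\<close>.\<close>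

lemma quadratic_form_le:
  assumes x: "x \<in> carrier_vec n" "x \<bullet> x = 1"
    and "\<And>i. i < n \<Longrightarrow> col P i \<bullet> x = 0 \<or> d i \<le> c"
  shows "x \<bullet> (A *\<^sub>v x) \<le> c"
proof -
  have "x \<bullet> (A *\<^sub>v x) \<le> (\<Sum>i<n. c * (col P i \<bullet> x)\<^sup>2)"
    unfolding quadratic_form_eq_sum_coords[OF x(1)]
    using assms(3) by (intro sum_mono) (force intro: mult_right_mono)
  also have "\<dots> = c * (x \<bullet> x)"
    unfolding scalar_prod_eq_sum_coords[OF x(1) x(1)] by (simp add: power2_eq_square sum_distrib_left)
  finally show ?thesis using x by simp
qed

lemma quadratic_form_ge:
  assumes x: "x \<in> carrier_vec n" "x \<bullet> x = 1"
    and "\<And>i. i < n \<Longrightarrow> col P i \<bullet> x = 0 \<or> c \<le> d i"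
  shows "c \<le> x \<bullet> (A *\<^sub>v x)"
proof -
  have "c * (x \<bullet> x) = (\<Sum>i<n. c * (col P i \<bullet> x)\<^sup>2)"
    unfolding scalar_prod_eq_sum_coords[OF x(1) x(1)] by (simp add: power2_eq_square sum_distrib_left)
  also have "\<dots> \<le> x \<bullet> (A *\<^sub>v x)"
    unfolding quadratic_form_eq_sum_coords[OF x(1)]
    using assms(3) by (intro sum_mono) (force intro: mult_right_mono)
  finally show ?thesis using x by simp
qed

text \<open>The decomposition into rank one matrices, entry by entry; it makes matrices with a
  common \<open>P\<close> easy to subtract.\<close>

lemma diagonalization_entry:
  assumes "i < n" "j < n"
  shows "A $$ (i, j) = (\<Sum>l<n. d l * (P $$ (i, l) * P $$ (j, l)))"
  unfolding diagonalizing_mat(4) using diagonalizing_mat(1) assms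
  by (subst mat_diag_mult_right[of _ n]) (auto simp: scalar_prod_def atLeast0LessThan mult_ac)

end

section \<open>The lower bound and its attainment\<close>

lemma eigval_gap_le_frobenius:
  assumes A: "A \<in> Sym n" and B: "B \<in> Sym n" and k: "1 \<le> k" "k < n"
    and eq: "eigval k B = eigval (k + 1) B"
  shows "(eigval (k + 1) A - eigval k A) / sqrt 2 \<le> frobenius_norm (A - B)"
proof -
  let ?a = "\<lambda>i. eigval (Suc i) A" and ?b = "\<lambda>i. eigval (Suc i) B"
  have Ac: "A \<in> carrier_mat n n" and Bc: "B \<in> carrier_mat n n" using A B by (auto simp: Sym_def)
  obtain P where P: "similar_mat_wit A (mat_diag n ?a) P P\<^sup>T"
    and a: "\<And>i j. i \<le> j \<Longrightarrow> j < n \<Longrightarrow> ?a i \<le> ?a j" using spectral_theorem[OF A] by blast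
  obtain Q where Q: "similar_mat_wit B (mat_diag n ?b) Q Q\<^sup>T"
    and b: "\<And>i j. i \<le> j \<Longrightarrow> j < n \<Longrightarrow> ?b i \<le> ?b j" using spectral_theorem[OF B] by blast
  note Pc = diagonalizing_mat(1)[OF Ac P] and Qc = diagonalizing_mat(1)[OF Bc Q]
  \<comment> \<open>Membership in an intersection of spans is expressed as orthogonality to the
    complementary eigenvectors. Each list has \<open>n - 1\<close> elements. Indices start at 0, so
    \<open>?a (k - 1)\<close> and \<open>?a k\<close> are the eigenvalues on the two sides of the
    gap.\<close>
  let ?xs = "map (col P) [k..<n] @ map (col Q) [0..<k - 1]"
  let ?ys = "map (col P) [0..<k] @ map (col Q) [Suc k..<n]"
  have "set ?xs \<subseteq> carrier_vec n" "length ?xs < n"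
    "set ?ys \<subseteq> carrier_vec n" "length ?ys < n" using Pc Qc k by auto
  then obtain x y where x: "x \<in> carrier_vec n" "x \<bullet> x = 1" "\<And>r. r \<in> set ?xs \<Longrightarrow> r \<bullet> x = 0"
    and y: "y \<in> carrier_vec n" "y \<bullet> y = 1" "\<And>r. r \<in> set ?ys \<Longrightarrow> r \<bullet> y = 0"
    by (metis unit_vec_orthogonal_to_few)
  have xP: "col P i \<bullet> x = 0" if "k \<le> i" "i < n" for i using x(3) that by auto
  have xQ: "col Q i \<bullet> x = 0" if "Suc i < k" for i using x(3) that by auto
  have yP: "col P i \<bullet> y = 0" if "i < k" for i using y(3) that by auto
  have yQ: "col Q i \<bullet> y = 0" if "k < i" "i < n" for i using y(3) that by auto
  \<comment> \<open>Thanks to this, \<open>?b k\<close> bounds the form of \<open>B\<close> from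
    below at \<open>x\<close> and from above at \<open>y\<close>, and cancels in the final
    difference.\<close>
  have eq': "?b (k - 1) = ?b k" using eq k by simp
  have "x \<bullet> (A *\<^sub>v x) \<le> ?a (k - 1)"
  proof (rule quadratic_form_le[OF Ac P x(1,2)])
    fix i assume "i < n"
    then show "col P i \<bullet> x = 0 \<or> ?a i \<le> ?a (k - 1)"
      using xP[of i] a[of i "k - 1"] k by (cases "k \<le> i") auto
  qed
  moreover have "?b k \<le> x \<bullet> (B *\<^sub>v x)"
  proof (rule quadratic_form_ge[OF Bc Q x(1,2)])
    fix i assume "i < n"
    then show "col Q i \<bullet> x = 0 \<or> ?b k \<le> ?b i"
      using xQ[of i] b[of "k - 1" i] k eq' by (cases "Suc i < k") auto
  qed
  moreover have "?a k \<le> y \<bullet> (A *\<^sub>v y)"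
  proof (rule quadratic_form_ge[OF Ac P y(1,2)])
    fix i assume "i < n"
    then show "col P i \<bullet> y = 0 \<or> ?a k \<le> ?a i"
      using yP[of i] a[of k i] by (cases "i < k") auto
  qed
  moreover have "y \<bullet> (B *\<^sub>v y) \<le> ?b k"
  proof (rule quadratic_form_le[OF Bc Q y(1,2)])
    fix i assume "i < n"
    then show "col Q i \<bullet> y = 0 \<or> ?b i \<le> ?b k"
      using yQ[of i] b[of i k] k by (cases "k < i") auto
  qed
  moreover have "z \<bullet> ((A - B) *\<^sub>v z) = z \<bullet> (A *\<^sub>v z) - z \<bullet> (B *\<^sub>v z)"
    if "z \<in> carrier_vec n" for z
    using that Ac Bc by (simp add: minus_mult_distrib_mat_vec scalar_prod_minus_distrib[of _ n])
  ultimately have "?a k - ?a (k - 1) \<le> y \<bullet> ((A - B) *\<^sub>v y) - x \<bullet> ((A - B) *\<^sub>v x)"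
    using x(1) y(1) by simp
  then have "(?a k - ?a (k - 1)) / sqrt 2
      \<le> (y \<bullet> ((A - B) *\<^sub>v y) - x \<bullet> ((A - B) *\<^sub>v x)) / sqrt 2"
    by (intro divide_right_mono) auto
  \<comment> \<open>No column of \<open>P\<close> has a nonzero coordinate in both: \<open>x\<close>
    uses indices below \<open>k\<close>, \<open>y\<close> the others.\<close>
  moreover have "x \<bullet> y = 0"
    unfolding scalar_prod_eq_sum_coords[OF Ac P x(1) y(1)]
    using xP yP by (intro sum.neutral) (metis lessThan_iff mult_eq_0_iff not_le)
  ultimately show ?thesis
    using quadratic_form_diff_le_frobenius[OF _ x(1,2) y(1,2), of "A - B"] Bc k
    by fastforce
qed

text \<open>Averaging the two eigenvalues shifts one by \<open>g / 2\<close> and the other by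
  \<open>- g / 2\<close>, so the change is \<open>g / 2\<close> times a matrix of Frobenius norm
  \<open>sqrt 2\<close>.\<close>

lemma eigval_gap_attained:
  assumes A: "A \<in> Sym n" and k: "1 \<le> k" "k < n"
  shows "\<exists>B\<in>Sym n. eigval k B = eigval (k + 1) B \<and>
    frobenius_norm (A - B) = (eigval (k + 1) A - eigval k A) / sqrt 2"
proof -
  let ?a = "\<lambda>i. eigval (Suc i) A"
  have Ac: "A \<in> carrier_mat n n" using A by (auto simp: Sym_def)
  obtain P where P: "similar_mat_wit A (mat_diag n ?a) P P\<^sup>T"
    and a: "\<And>i j. i \<le> j \<Longrightarrow> j < n \<Longrightarrow> ?a i \<le> ?a j" using spectral_theorem[OF A] by blast
  note Pc = diagonalizing_mat[OF Ac P]
  obtain l where l: "k = Suc l" "Suc l < n" using k by (cases k) auto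
  define g where "g = ?a (Suc l) - ?a l"
  define c where "c = (?a l + ?a (Suc l)) / 2"
  define b where "b i = (if i = l \<or> i = Suc l then c else ?a i)" for i
  define B where "B = P * mat_diag n b * P\<^sup>T"
  have Bc: "B \<in> carrier_mat n n" unfolding B_def using Pc by auto
  have BP: "similar_mat_wit B (mat_diag n b) P P\<^sup>T"
    using Pc Bc by (intro similar_mat_witI[of _ _ n]) (auto simp: B_def)
  have "B\<^sup>T = B"
    using diagonalization_entry[OF Bc BP] Bc by (intro eq_matI) (auto simp: mult.commute)
  then have BS: "B \<in> Sym n" using Bc by (simp add: Sym_def)
  \<comment> \<open>The mean lies between the two neighbours it replaces, so the diagonal stays
    sorted and the equal entries are still the eigenvalues numbered \<open>k\<close> and
    \<open>k + 1\<close>.\<close>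
  have mono: "b i \<le> b j" if "i \<le> j" "j < n" for i j
    using a[OF that] a[of i l] a[of "Suc l" j] a[of l "Suc l"] that l
    by (auto simp: b_def c_def not_less_eq_eq le_less_Suc_eq split: if_splits)
  have "eigval k B = b l" "eigval (k + 1) B = b (Suc l)"
    using eigval_of_diagonalization[OF BP mono, of k] eigval_of_diagonalization[OF BP mono, of "k + 1"] l
    by auto
  then have eq: "eigval k B = eigval (k + 1) B" by (simp add: b_def)
  let ?x = "col P l" and ?y = "col P (Suc l)"
  have col: "col P i \<bullet> col P j = (if i = j then 1 else 0)" if "i < n" "j < n" for i j
    using arg_cong[OF Pc(3), of "\<lambda>M. M $$ (i, j)"] Pc(1) that by simp
  have entry: "(A - B) $$ (i, j) = g / 2 * (?y $ i * ?y $ j - ?x $ i * ?x $ j)"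
    if ij: "i < n" "j < n" for i j
  proof -
    have "(A - B) $$ (i, j) = (\<Sum>m<n. (?a m - b m) * (P $$ (i, m) * P $$ (j, m)))"
      using diagonalization_entry[OF Ac P ij] diagonalization_entry[OF Bc BP ij] Ac Bc ij
      by (simp add: sum_subtractf left_diff_distrib)
    also have "\<dots> = (\<Sum>m\<in>{l, Suc l}. (?a m - b m) * (P $$ (i, m) * P $$ (j, m)))"
      using l by (intro sum.mono_neutral_right) (auto simp: b_def)
    also have "\<dots> = g / 2 * (?y $ i * ?y $ j - ?x $ i * ?x $ j)"
      using Pc(1) l ij by (simp add: b_def c_def g_def field_simps)
    finally show ?thesis .
  qed
  have "frobenius_norm (A - B)
      = sqrt (\<Sum>i<n. \<Sum>j<n. (g / 2)\<^sup>2 * (?y $ i * ?y $ j - ?x $ i * ?x $ j)\<^sup>2)"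
    unfolding frobenius_norm_def using Bc
    by (intro arg_cong[of _ _ sqrt] sum.cong) (simp_all add: entry power_mult_distrib power_divide del: index_minus_mat(1))
  also have "\<dots> = sqrt ((g / 2)\<^sup>2 * 2)"
    using orthonormal_outer_prod_diff[of ?x n ?y] col l
      carrier_vecI[of ?x n] carrier_vecI[of ?y n] Pc(1)
    by (simp flip: sum_distrib_left)
  also have "(g / 2)\<^sup>2 * 2 = (g / sqrt 2)\<^sup>2" by (simp add: power_divide)
  \<comment> \<open>The root of the square is the absolute value; \<open>g\<close> is nonnegative
    because the eigenvalues are sorted.\<close>
  also have "sqrt \<dots> = g / sqrt 2"
    using a[of l "Suc l"] l by (simp add: g_def)
  finally have "frobenius_norm (A - B) = (eigval (k + 1) A - eigval k A) / sqrt 2"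
    using l by (simp add: g_def)
  with BS eq show ?thesis by blast
qed

text \<open>The graph enters the argument here: symmetric weights are subtracted from a diagonal
  matrix.\<close>

lemma laplacian_Sym:
  assumes "weighted_graph n E W"
  shows "laplacian W \<in> Sym n"
proof -
  have W: "W \<in> carrier_mat n n" and sym: "\<And>i j. i < n \<Longrightarrow> j < n \<Longrightarrow> W $$ (i, j) = W $$ (j, i)"
    using assms unfolding weighted_graph_def by blast+
  have "(laplacian W)\<^sup>T = laplacian W"
    using W sym by (intro eq_matI) (auto simp: laplacian_def diag_of_vec_def mat_diag_def)
  then show ?thesis
    using W by (auto simp: Sym_def laplacian_def diag_of_vec_def mat_diag_def)
qed

theorem theorem3p1:
  fixes n k :: nat and E :: "(nat \<times> nat) set" and W :: "real mat"
  assumes "weighted_graph n E W"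
    and "1 \<le> k" and "k \<le> n - 1"
  shows "is_minimum
    ((eigval (k + 1) (laplacian W) - eigval k (laplacian W)) / sqrt 2)
    {frobenius_norm (laplacian W - L') | L'. L' \<in> Sym n \<and> eigval k L' = eigval (k + 1) L'}"
proof -
  have k: "1 \<le> k" "k < n" using assms(2,3) by auto
  note L = laplacian_Sym[OF assms(1)]
  from eigval_gap_attained[OF L k] obtain B where
    "B \<in> Sym n" "eigval k B = eigval (k + 1) B"
    "(eigval (k + 1) (laplacian W) - eigval k (laplacian W)) / sqrt 2 = frobenius_norm (laplacian W - B)"
    by metis
  with eigval_gap_le_frobenius[OF L _ k] show ?thesis
    unfolding is_minimum_def by blast
qed

end
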